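(* Let $k=3$. If $G$ is a triangle-free graph of order $n$ with $e_\phi(G)=ex_\phi(n,K_3)$, then $G\in\mathcal{G}_n^*$, where $\mathcal{G}_n^*$ is the set of complete bipartite graphs $K_{x,n-x}$ for which $x(n-x)$ is closest to $(n^2-3n+4)/4$.
   Context: All graphs are finite, simple and undirected. For a positive integer $k$ and a graph $G$ with degree sequence $d_1,\ldots,d_n$, define $e_\phi(G)=\sum_{i=1}^n\binom{d_i}{k}$. $ex_\phi(n,K_3)$ denotes the maximum of $e_\phi(G)$ over all triangle-free graphs $G$ on $n$ vertices. Throughout, $k\leq n/2$ is assumed. *)

theory Defs
  imports Complex_Main "Graph_Theory.Graph_Theory"
begin

text \<open>
  A finite simple undirected graph is a \<open>pair_graph\<close>: a finite vertex set \<open>pverts G\<close> with an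
  irreflexive symmetric set \<open>parcs G\<close> of ordered pairs. An undirected edge \<open>{u,v}\<close> is represented
  by the two arcs \<open>(u,v)\<close> and \<open>(v,u)\<close>, so the degree of a vertex is its out-degree.
\<close>

definition triangle_free :: "'a pair_pre_digraph \<Rightarrow> bool" where
  "triangle_free G \<longleftrightarrow>
     \<not> (\<exists>u v w. (u, v) \<in> parcs G \<and> (v, w) \<in> parcs G \<and> (u, w) \<in> parcs G)"

definition e_phi :: "nat \<Rightarrow> 'a pair_pre_digraph \<Rightarrow> nat" where
  "e_phi k G = (\<Sum>v\<in>pverts G. out_degree (with_proj G) v choose k)"

text \<open>
  Every graph on \<open>n\<close> vertices is isomorphic to one with vertices in \<open>nat\<close>, so the maximum may be
  taken over graphs of that vertex type. The set is nonempty (it contains the value of the edgeless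
  graph) and bounded by \<open>n * (n choose k)\<close>, so \<open>Max\<close> is attained.
\<close>

definition ex_phi_K3 :: "nat \<Rightarrow> nat \<Rightarrow> nat" where
  "ex_phi_K3 k n =
     Max {e_phi k G | G :: nat pair_pre_digraph.
            pair_graph G \<and> card (pverts G) = n \<and> triangle_free G}"

text \<open>
  The part sizes range over all \<open>x\<close> for which both parts of \<open>K\<^bsub>x,n-x\<^esub>\<close> are nonempty; several
  \<open>x\<close> can be equally close. \<open>K\<^bsub>x,n-x\<^esub> (with_proj G)\<close> says that \<open>G\<close> is a complete bipartite graph
  with parts of sizes \<open>x\<close> and \<open>n - x\<close>.
\<close>

definition G_star :: "nat \<Rightarrow> 'a pair_pre_digraph set" where
  "G_star n = {G. \<exists>x\<in>{1..<n}.
     (\<forall>y\<in>{1..<n}.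
        \<bar>real x * (real n - real x) - (real n ^ 2 - 3 * real n + 4) / 4\<bar>
          \<le> \<bar>real y * (real n - real y) - (real n ^ 2 - 3 * real n + 4) / 4\<bar>) \<and>
     K\<^bsub>x,n-x\<^esub> (with_proj G)}"

end

theory Submission
  imports Defs
begin

text \<open>
  Let \<open>v\<close> be a vertex of maximum degree \<open>d\<close> in a triangle-free graph \<open>G\<close>. Its neighbourhood \<open>N\<close> is
  independent, so vertices of \<open>N\<close> have degree at most \<open>n - d\<close> while all others have degree at most
  \<open>d\<close>: the complete bipartite graph between \<open>N\<close> and its complement dominates all degrees of \<open>G\<close>.
  Equality in the resulting bound on \<open>e_phi\<close> forces \<open>G\<close> to be that graph. Finally, with
  \<open>p = x (n - x)\<close>, six times the value of \<open>e_phi 3\<close> on \<open>K\<^bsub>x,n-x\<^esub>\<close> is \<open>p (n\<^sup>2 - 3 n + 4 - 2 p)\<close>,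
  a downward parabola in \<open>p\<close> with vertex \<open>(n\<^sup>2 - 3 n + 4) / 4\<close>.
\<close>

section \<open>Binomial coefficients\<close>

text \<open>By Pascal's rule the last step up to \<open>b\<close> adds \<open>c choose j\<close>,
  which is positive because \<open>k \<le> b\<close>; below \<open>k\<close> all values are
  0.\<close>

lemma binomial_strict_mono_left:
  fixes a b :: nat
  assumes "a < b" and "0 < k" and "k \<le> b"
  shows "a choose k < b choose k"
proof -
  obtain c where c: "b = Suc c" using assms(1) by (cases b) auto
  obtain j where j: "k = Suc j" using assms(2) by (cases k) auto
  have "a choose k \<le> c choose k" using assms(1) c by (intro binomial_right_mono) simp
  also have "\<dots> < b choose k" using assms(3) c j by simp
  finally show ?thesis .
qed

lemma binomial_three: "real (m choose 3) = real m * (real m - 1) * (real m - 2) / 6"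
proof (induction m)
  case 0
  then show ?case by simp
next
  case (Suc m)
  have two: "real (m choose 2) = real m * (real m - 1) / 2"
    by (induction m) (simp_all add: numeral_2_eq_2 field_simps)
  have "Suc m choose 3 = (m choose 2) + (m choose 3)"
    by (simp add: numeral_3_eq_3 numeral_2_eq_2)
  then have "real (Suc m choose 3) = real (m choose 2) + real (m choose 3)"
    by simp
  then show ?case
    by (simp add: two Suc.IH field_simps)
qed

section \<open>Degrees and complete bipartite graphs\<close>

lemma out_degree_with_proj: "out_degree (with_proj G) v = card (parcs G `` {v})"
proof -
  have "out_arcs (with_proj G) v = Pair v ` (parcs G `` {v})"
    by (auto simp: out_arcs_def)
  then show ?thesis
    by (simp add: out_degree_def card_image inj_on_def)
qed

definition bipartite_value :: "nat \<Rightarrow> nat \<Rightarrow> nat \<Rightarrow> nat" where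
  "bipartite_value k n x = x * (n - x choose k) + (n - x) * (x choose k)"

text \<open>Factoring out \<open>p\<close> leaves (a-1)(a-2) + (b-1)(b-2) with a = x and b = n - x;
  then a + b = n and a^2 + b^2 = n^2 - 2p eliminate x.\<close>

lemma bipartite_value_three:
  fixes n x :: nat
  assumes "x \<le> n"
  defines "p \<equiv> real x * (real n - real x)"
  shows "6 * real (bipartite_value 3 n x) = p * ((real n)\<^sup>2 - 3 * real n + 4 - 2 * p)"
  using assms(1)
  by (simp add: bipartite_value_def binomial_three of_nat_diff p_def power2_eq_square field_simps)

definition complete_bipartite :: "'a set \<Rightarrow> 'a set \<Rightarrow> 'a pair_pre_digraph" where
  "complete_bipartite U V = \<lparr>pverts = U \<union> V, parcs = U \<times> V \<union> V \<times> U\<rparr>"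

lemma pair_graph_complete_bipartite:
  assumes "finite U" "finite V" "U \<inter> V = {}"
  shows "pair_graph (complete_bipartite U V)"
proof (rule pair_graphI_complete_bipartite)
  show "K\<^bsub>card U,card V\<^esub> (with_proj (complete_bipartite U V))"
    unfolding complete_bipartite_digraph_pair_def complete_bipartite_def
    using assms by auto
qed

lemma triangle_free_complete_bipartite:
  "U \<inter> V = {} \<Longrightarrow> triangle_free (complete_bipartite U V)"
  by (auto simp: triangle_free_def complete_bipartite_def)

lemma e_phi_complete_bipartite:
  assumes "finite U" "finite V" "U \<inter> V = {}"
  shows "e_phi k (complete_bipartite U V) = bipartite_value k (card U + card V) (card U)"
proof -
  let ?G = "complete_bipartite U V"
  have U: "parcs ?G `` {u} = V" if "u \<in> U" for u
    using that assms(3) by (auto simp: complete_bipartite_def)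
  have V: "parcs ?G `` {v} = U" if "v \<in> V" for v
    using that assms(3) by (auto simp: complete_bipartite_def)
  have "e_phi k ?G = (\<Sum>v\<in>U \<union> V. card (parcs ?G `` {v}) choose k)"
    by (simp add: e_phi_def out_degree_with_proj) (simp add: complete_bipartite_def)
  also have "\<dots> = (\<Sum>u\<in>U. card V choose k) + (\<Sum>v\<in>V. card U choose k)"
    using assms by (simp add: sum.union_disjoint U V)
  finally show ?thesis
    by (simp add: bipartite_value_def)
qed

text \<open>\<open>Max\<close> bounds its members only on a finite set, so the crude bound
  \<open>n * (n choose k)\<close> comes first.\<close>

lemma e_phi_le_ex_phi_K3:
  fixes G :: "nat pair_pre_digraph"
  assumes "pair_graph G" "card (pverts G) = n" "triangle_free G"
  shows "e_phi k G \<le> ex_phi_K3 k n"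
proof -
  let ?S = "{e_phi k G | G :: nat pair_pre_digraph.
    pair_graph G \<and> card (pverts G) = n \<and> triangle_free G}"
  have "e_phi k H \<le> n * (n choose k)"
    if "pair_graph H" "card (pverts H) = n" for H :: "nat pair_pre_digraph"
  proof -
    interpret pair_graph H by fact
    have "card (parcs H `` {v}) \<le> n" for v
      using that(2) pair_finite_verts in_arcsD2 by (metis Image_singleton_iff card_mono subsetI)
    then have "e_phi k H \<le> (\<Sum>v\<in>pverts H. n choose k)"
      unfolding e_phi_def out_degree_with_proj by (intro sum_mono binomial_right_mono)
    then show ?thesis using that(2) by simp
  qed
  then have "?S \<subseteq> {..n * (n choose k)}" by auto
  then have "finite ?S" by (rule finite_subset) simp
  then show ?thesis
    unfolding ex_phi_K3_def using assms by (intro Max_ge) auto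
qed

lemma bipartite_value_le_ex_phi_K3:
  assumes "x \<le> n"
  shows "bipartite_value k n x \<le> ex_phi_K3 k n"
proof -
  \<comment> \<open>The competitor lives on \<open>nat\<close>, the vertex type over which
    \<open>ex_phi_K3\<close> takes its maximum.\<close>
  let ?G = "complete_bipartite {..<x} {x..<n}"
  have "e_phi k ?G = bipartite_value k n x"
    using assms by (subst e_phi_complete_bipartite) auto
  moreover have "e_phi k ?G \<le> ex_phi_K3 k n"
  proof (rule e_phi_le_ex_phi_K3)
    show "pair_graph ?G" by (rule pair_graph_complete_bipartite) auto
    show "triangle_free ?G" by (rule triangle_free_complete_bipartite) auto
    show "card (pverts ?G) = n"
      using assms by (simp add: complete_bipartite_def ivl_disj_un(8))
  qed
  ultimately show ?thesis by simp
qed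

section \<open>Extremal triangle-free graphs\<close>

lemma extremal_complete_bipartite:
  fixes G :: "'a pair_pre_digraph"
  assumes "pair_graph G" and n: "card (pverts G) = n" and tf: "triangle_free G"
    and ex: "e_phi k G = ex_phi_K3 k n" and k: "0 < k" "2 * k \<le> n"
  obtains x where "x \<in> {1..<n}" "ex_phi_K3 k n = bipartite_value k n x" "K\<^bsub>x,n-x\<^esub> (with_proj G)"
proof -
  interpret pair_graph G by fact
  define N where "N u = parcs G `` {u}" for u
  define D where "D u = card (N u)" for u
  have sym: "(b, a) \<in> parcs G" if "(a, b) \<in> parcs G" for a b
    using pair_sym_arcs that by (auto simp: symmetric_def dest: symD)
  have N_sub: "N u \<subseteq> pverts G" for u
    using in_arcsD2 by (auto simp: N_def)
  have fin_N: "finite (N u)" for u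
    using N_sub pair_finite_verts finite_subset by blast
  have N_disj: "N u \<inter> N w = {}" if "w \<in> N u" for u w
    using tf that by (auto simp: triangle_free_def N_def)
  have e_phi: "e_phi k G = (\<Sum>u\<in>pverts G. D u choose k)"
    by (simp add: e_phi_def out_degree_with_proj D_def N_def)
  have ne: "pverts G \<noteq> {}" using n k by auto
  obtain v where v: "v \<in> pverts G" and vmax: "\<And>w. w \<in> pverts G \<Longrightarrow> D w \<le> D v"
    using obtains_MAX[OF pair_finite_verts ne, of D]
    by (metis Max_ge finite_imageI imageI pair_finite_verts)
  define A where "A = N v"
  define B where "B = pverts G - A"
  have A: "A \<subseteq> pverts G" "finite A" and B: "finite B" "A \<inter> B = {}" "A \<union> B = pverts G"
    using N_sub fin_N pair_finite_verts by (auto simp: A_def B_def)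
  have cA: "card A = D v" by (simp add: A_def D_def)
  have cB: "card B = n - D v"
    unfolding B_def using A n by (simp add: card_Diff_subset cA)
  have D_le_n: "D v \<le> n" using cA A n card_mono[OF pair_finite_verts] by metis
  have N_A: "N u \<subseteq> B" if "u \<in> A" for u
    using N_disj[of u v] that N_sub by (auto simp: A_def B_def)
  have D_A: "D u \<le> n - D v" if "u \<in> A" for u
    using card_mono[OF B(1) N_A[OF that]] by (simp add: D_def cB)

  \<comment> \<open>The degree of \<open>u\<close> in the complete bipartite graph between
    \<open>A\<close> and \<open>B\<close>.\<close>
  define H where "H u = (if u \<in> A then n - D v else D v)" for u
  have D_H: "D u \<le> H u" if "u \<in> pverts G" for u
    using that D_A vmax by (simp add: H_def)
  have "(\<Sum>u\<in>A \<union> B. H u choose k) = (\<Sum>u\<in>A. n - D v choose k) + (\<Sum>u\<in>B. D v choose k)"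
    unfolding sum.union_disjoint[OF A(2) B(1,2)]
    using B(2) by (intro arg_cong2[where f="(+)"] sum.cong) (auto simp: H_def)
  then have sum_H: "(\<Sum>u\<in>pverts G. H u choose k) = bipartite_value k n (D v)"
    by (simp add: B cA cB bipartite_value_def)
  have le: "(\<Sum>u\<in>pverts G. D u choose k) \<le> (\<Sum>u\<in>pverts G. H u choose k)"
    by (intro sum_mono binomial_right_mono D_H)
  \<comment> \<open>The right-hand sum is the value of a complete bipartite graph, hence at most
    \<open>ex_phi_K3 k n\<close>, which is the left-hand sum.\<close>
  have eq: "(\<Sum>u\<in>pverts G. D u choose k) = (\<Sum>u\<in>pverts G. H u choose k)"
    using le bipartite_value_le_ex_phi_K3[OF D_le_n, of k] ex by (simp add: sum_H e_phi)
  then have choose_eq: "D u choose k = H u choose k" if "u \<in> pverts G" for u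
    by (rule sum_mono_inv) (use that pair_finite_verts binomial_right_mono D_H in auto)
  \<comment> \<open>Equal binomials fix the degree only if \<open>H u\<close> reaches
    \<open>k\<close>; below that both vanish.\<close>
  have D_eq: "D u = H u" if "u \<in> pverts G" "k \<le> H u" for u
    using choose_eq[OF that(1)] D_H[OF that(1)] binomial_strict_mono_left[OF _ k(1) that(2)]
    by (metis le_neq_implies_less less_irrefl)

  \<comment> \<open>The star has a centre of degree \<open>n - 1 \<ge> k\<close>, so the maximum is
    positive and some degree of \<open>G\<close> reaches \<open>k\<close>. This makes
    \<open>D_eq\<close> available on all of \<open>B\<close>.\<close>
  have "0 < bipartite_value k n 1"
    using k by (auto simp: bipartite_value_def)
  also have "\<dots> \<le> (\<Sum>u\<in>pverts G. D u choose k)"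
    using bipartite_value_le_ex_phi_K3[of 1 n k] k ex e_phi by simp
  finally have "\<exists>u\<in>pverts G. D u choose k \<noteq> 0"
    by (metis (no_types, lifting) less_irrefl sum.neutral)
  then have k_le: "k \<le> D v"
    using vmax by (metis binomial_eq_0 le_trans not_le)
  have A_ne: "A \<noteq> {}" using k k_le cA by auto
  have v_B: "v \<in> B" using v pair_no_loops[of "(v, v)"] by (auto simp: A_def B_def N_def)
  then have D_less: "D v < n" using cB B(1) by (metis card_gt_0_iff empty_iff zero_less_diff)

  have N_B: "N w \<subseteq> A" if w: "w \<in> B" for w
  proof (rule ccontr)
    (* An arc inside B: if k <= n - d, every u in A is joined to all of B, giving a triangle;
       otherwise its ends have disjoint neighbourhoods of size d > n - k >= n / 2. *)
    assume "\<not> N w \<subseteq> A"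
    then obtain w' where w': "w' \<in> N w" "w' \<in> B" using N_sub[of w] B by blast
    show False
    proof (cases "k \<le> n - D v")
      case True
      obtain u where u: "u \<in> A" using A_ne by auto
      then have "card (N u) = card B"
        using D_eq[of u] True A by (auto simp: H_def cB D_def)
      then have "N u = B" using card_subset_eq[OF B(1) N_A[OF u]] by simp
      then show False
        using w w' tf by (auto simp: triangle_free_def N_def)
    next
      case False
      have "D w = D v" "D w' = D v"
        using D_eq[of w] D_eq[of w'] w w' k_le by (auto simp: H_def B_def)
      moreover have "card (N w \<union> N w') = D w + D w'"
        using N_disj[OF w'(1)] fin_N by (simp add: card_Un_disjoint D_def)
      moreover have "card (N w \<union> N w') \<le> n"
        using card_mono[OF pair_finite_verts, of "N w \<union> N w'"] N_sub n by auto
      ultimately show False using False k by linarith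
    qed
  qed
  have N_B_eq: "N w = A" if w: "w \<in> B" for w
  proof -
    have "D w = D v" using D_eq[of w] w k_le by (auto simp: H_def B_def)
    then show ?thesis
      using card_subset_eq[OF A(2) N_B[OF w]] by (simp add: D_def cA)
  qed
  have arcs: "parcs G = A \<times> B \<union> B \<times> A"
  proof (intro set_eqI iffI)
    fix e assume e: "e \<in> parcs G"
    obtain a b where ab: "e = (a, b)" by (cases e)
    then have "b \<in> N a" "a \<in> A \<union> B" using e in_arcsD1 B by (auto simp: N_def)
    then show "e \<in> A \<times> B \<union> B \<times> A" using ab N_A N_B by blast
  next
    fix e assume "e \<in> A \<times> B \<union> B \<times> A"
    \<comment> \<open>If \<open>n - D v < k\<close>, then \<open>D_eq\<close> says nothing about
      \<open>A\<close>; arcs leaving \<open>A\<close> are obtained by reversing those leaving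
      \<open>B\<close>.\<close>
    then show "e \<in> parcs G" using N_B_eq sym unfolding N_def by blast
  qed
  show thesis
  proof
    show "D v \<in> {1..<n}" using k k_le D_less by simp
    show "ex_phi_K3 k n = bipartite_value k n (D v)" using ex e_phi eq sum_H by simp
    show "K\<^bsub>D v,n - D v\<^esub> (with_proj G)"
      unfolding complete_bipartite_digraph_pair_def
      using arcs A B cA cB pair_finite_verts by metis
  qed
qed

text \<open>Completing the square: p (N - 2p) = N^2/8 - 2 (p - N/4)^2, so a larger value means a
  smaller distance to the vertex.\<close>

lemma abs_diff_quarter_le:
  fixes p q N :: real
  assumes "q * (N - 2 * q) \<le> p * (N - 2 * p)"
  shows "\<bar>p - N / 4\<bar> \<le> \<bar>q - N / 4\<bar>"
proof -
  have "(p - N / 4)\<^sup>2 \<le> (q - N / 4)\<^sup>2"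
    using assms by (simp add: power2_eq_square field_simps)
  then show ?thesis by (simp add: abs_le_square_iff)
qed

theorem theorem4:
  fixes k n :: nat and G :: "'a pair_pre_digraph"
  assumes "k = 3" and "real k \<le> real n / 2"
    and "pair_graph G" and "card (pverts G) = n" and "triangle_free G"
    and "e_phi k G = ex_phi_K3 k n"
  shows "G \<in> G_star n"
proof -
  have k: "0 < k" "2 * k \<le> n" using assms(1,2) by linarith+
  obtain x where x: "x \<in> {1..<n}" "ex_phi_K3 k n = bipartite_value k n x"
    "K\<^bsub>x,n-x\<^esub> (with_proj G)"
    using extremal_complete_bipartite[OF assms(3-6) k] .
  have "\<bar>real x * (real n - real x) - (real n ^ 2 - 3 * real n + 4) / 4\<bar>
      \<le> \<bar>real y * (real n - real y) - (real n ^ 2 - 3 * real n + 4) / 4\<bar>" if "y \<in> {1..<n}" for y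
  proof (rule abs_diff_quarter_le)
    \<comment> \<open>The extremal number equals the value at \<open>x\<close> and bounds the value
      at every \<open>y\<close>.\<close>
    have "bipartite_value 3 n y \<le> bipartite_value 3 n x"
      using bipartite_value_le_ex_phi_K3[of y n k] that x(2) assms(1) by simp
    then have "6 * real (bipartite_value 3 n y) \<le> 6 * real (bipartite_value 3 n x)" by linarith
    moreover have "x \<le> n" "y \<le> n" using that x(1) by auto
    ultimately show "real y * (real n - real y) *
          (real n ^ 2 - 3 * real n + 4 - 2 * (real y * (real n - real y)))
        \<le> real x * (real n - real x) *
          (real n ^ 2 - 3 * real n + 4 - 2 * (real x * (real n - real x)))"
      by (simp only: bipartite_value_three)
  qed
  then show ?thesis using x(1,3) unfolding G_star_def by blast
qed

end
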